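(* If $h:[0,\infty)\to[0,1]$ is an attainable failure probability bound, then for any $0<s<t$, $$\tilde h\left(\frac{2}{\sqrt t}\right)+\tilde h\left(\frac{2}{\sqrt s}\right)+2\tilde h\left(\frac{1}{\sqrt s}\right)\ \ge\ \mathrm{erfc}\left(\frac{1}{\sqrt{2t}}\right)-\mathrm{erfc}\left(\frac{1}{\sqrt{2s}}\right)-\mathrm{erfc}\left(\frac{1}{4\sqrt{2(t-s)}}\right),$$ where $\tilde h(x):=h(x)-\mathrm{erf}(x/(2\sqrt2))$ and $\mathrm{erfc}(x):=1-\mathrm{erf}(x)$. Hence $x\mapsto\mathrm{erf}(x/(2\sqrt2))$ is not an attainable failure probability bound. Moreover, $1.0025$ is not an attainable multiplicative gap.
   Context: $\mathrm{BM}(\alpha)$ denotes the law of standard one-dimensional Brownian motion started at $\alpha\in\mathbb{R}$ (on $C([0,\infty),\mathbb{R})$). $\mathrm{erf}(\gamma):=\int_{-\gamma}^{\gamma}\frac{e^{-x^2}}{\sqrt\pi}\,\mathrm{d}x$. A coupling of $\{\mathrm{BM}(\alpha)\}_{\alpha\in\mathbb{R}}$ is a family of processes $\{\{\tilde X_{\alpha,t}\}_{t\ge0}\}_{\alpha\in\mathbb{R}}$ on a common probability space such that $\{\tilde X_{\alpha,t}\}_{t\ge0}\sim\mathrm{BM}(\alpha)$ for each $\alpha\in\mathbb{R}$. A function $h:[0,\infty)\to[0,1]$ is an attainable failure probability bound if there exists a coupling $\{\{\tilde X_{\alpha,t}\}_{t\ge0}\}_{\alpha\in\mathbb{R}}$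 of $\{\mathrm{BM}(\alpha)\}_{\alpha\in\mathbb{R}}$ such that $$\mathbf{P}\left(\exists\,t\ge s\ \text{s.t.}\ \tilde X_{\alpha,t}\ne\tilde X_{\beta,t}\right)\le h\left(\frac{|\alpha-\beta|}{\sqrt s}\right)\quad\text{for all }\alpha,\beta\in\mathbb{R},\ s>0.$$ A number $c>0$ is an attainable multiplicative gap if $x\mapsto\mathrm{erf}(x\sqrt c/(2\sqrt2))$ is an attainable failure probability bound. *)

theory Defs
  imports "HOL-Probability.Probability"
begin

definition erf :: "real \<Rightarrow> real" where
  "erf \<gamma> = (LBINT x=ereal (- \<gamma>)..ereal \<gamma>. exp (- x\<^sup>2) / sqrt pi)"

definition erfc :: "real \<Rightarrow> real" where
  "erfc x = 1 - erf x"

(* X has law BM(\<alpha>) on C([0,\<infinity>)): every path is continuous, and the finite-dimensional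
   distributions are those of standard Brownian motion started at \<alpha>, which determines the law.
   The time index is a real number, and only nonnegative times are constrained. *)
locale brownian_motion = prob_space M for M :: "'w measure" +
  fixes \<alpha> :: real and X :: "real \<Rightarrow> 'w \<Rightarrow> real"
  assumes measurable_X: "\<And>t. 0 \<le> t \<Longrightarrow> X t \<in> borel_measurable M"
    and continuous_paths: "\<And>\<omega>. \<omega> \<in> space M \<Longrightarrow> continuous_on {0..} (\<lambda>t. X t \<omega>)"
    and initial_value: "AE \<omega> in M. X 0 \<omega> = \<alpha>"
    and gaussian_increments:
      "\<And>s t. 0 \<le> s \<Longrightarrow> s < t \<Longrightarrow>
        distributed M lborel (\<lambda>\<omega>. X t \<omega> - X s \<omega>) (normal_density 0 (sqrt (t - s)))"
    and independent_increments:
      "\<And>(n :: nat) (\<tau> :: nat \<Rightarrow> real). 0 \<le> \<tau> 0 \<Longrightarrow> strict_mono_on {..n} \<tau> \<Longrightarrow>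
        indep_vars (\<lambda>_. borel) (\<lambda>i \<omega>. X (\<tau> (Suc i)) \<omega> - X (\<tau> i) \<omega>) {..<n}"

definition brownian_coupling :: "'w measure \<Rightarrow> (real \<Rightarrow> real \<Rightarrow> 'w \<Rightarrow> real) \<Rightarrow> bool" where
  "brownian_coupling M X \<longleftrightarrow> (\<forall>\<alpha>. brownian_motion M \<alpha> (X \<alpha>))"

(* HOL cannot quantify existentially over types, so the type of sample points is a parameter:
   the coupling may use any probability space whose points have type 'w. A statement about all
   couplings is obtained by leaving 'w a free type variable of the theorem.
   The event below is measurable because the paths are continuous. *)
definition attainable_failure_bound :: "'w itself \<Rightarrow> (real \<Rightarrow> real) \<Rightarrow> bool" where
  "attainable_failure_bound W h \<longleftrightarrow>
    h \<in> {0..} \<rightarrow> {0..1} \<and>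
    (\<exists>(M :: 'w measure) X. brownian_coupling M X \<and>
      (\<forall>\<alpha> \<beta> s. 0 < s \<longrightarrow>
        measure M {\<omega> \<in> space M. \<exists>t\<ge>s. X \<alpha> t \<omega> \<noteq> X \<beta> t \<omega>} \<le> h (\<bar>\<alpha> - \<beta>\<bar> / sqrt s)))"

definition attainable_multiplicative_gap :: "'w itself \<Rightarrow> real \<Rightarrow> bool" where
  "attainable_multiplicative_gap W c \<longleftrightarrow>
    0 < c \<and> attainable_failure_bound W (\<lambda>x. erf (x * sqrt c / (2 * sqrt 2)))"

definition excess :: "(real \<Rightarrow> real) \<Rightarrow> real \<Rightarrow> real" where
  "excess h x = h x - erf (x / (2 * sqrt 2))"

end

theory Submission
  imports Defs "HOL-Real_Asymp.Real_Asymp"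
begin

text \<open>
  Only the paths \<open>L, C, R\<close> started at \<open>-1, 0, 1\<close> at the times \<open>s < t\<close> matter. At time \<open>s\<close>, up to the
  excess failure probability, \<open>L\<close> has merged with \<open>R\<close> unless \<open>L < 0 \<le> R\<close>, it has merged with \<open>C\<close> unless
  \<open>L < -1/2\<close>, and \<open>R\<close> has merged with \<open>C\<close> unless \<open>R \<ge> 1/2\<close>. So if \<open>L\<close> and \<open>R\<close> have not merged by time \<open>s\<close>,
  then \<open>L < -1/2\<close> or \<open>R \<ge> 1/2\<close>, and their distance exceeds \<open>1/2\<close>. To merge by time \<open>t\<close> one of them must
  then move by \<open>1/4\<close> towards the other, which has probability at most \<open>erfc (1 / (4 * sqrt (2 * (t - s))))\<close>.
  But \<open>L\<close> and \<open>R\<close> must merge between \<open>s\<close> and \<open>t\<close> with probability about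
  \<open>erfc (1 / sqrt (2 * t)) - erfc (1 / sqrt (2 * s))\<close>, which is of the larger order \<open>t - s\<close>.
\<close>

section \<open>The error function: derivative, limit and explicit bounds\<close>

lemma DERIV_erf: "(erf has_real_derivative 2 / sqrt pi * exp (- x\<^sup>2)) (at x)"
proof -
  \<comment> \<open>An antiderivative on the whole line gives \<open>erf x = F x - F (- x)\<close>
    for either sign of \<open>x\<close>, because the interval integral is signed. Both ends
    contribute equally, hence the factor 2.\<close>
  obtain F :: "real \<Rightarrow> real"
    where F: "\<And>x. (F has_real_derivative exp (- x\<^sup>2) / sqrt pi) (at x)"
    using einterval_antiderivative[of "-\<infinity>" \<infinity> "\<lambda>x. exp (- x\<^sup>2) / sqrt pi"]
    by (auto simp: has_real_derivative_iff_has_vector_derivative intro!: continuous_intros)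
  have "erf = (\<lambda>x. F x - F (- x))"
    unfolding erf_def
    by (intro ext interval_integral_FTC_finite)
      (auto intro!: continuous_intros
        has_vector_derivative_at_within[OF F[unfolded has_real_derivative_iff_has_vector_derivative]])
  moreover have "((\<lambda>x. F x - F (- x)) has_real_derivative 2 / sqrt pi * exp (- x\<^sup>2)) (at x)"
    by (auto intro!: derivative_eq_intros F DERIV_chain2[OF F])
  ultimately show ?thesis by simp
qed

lemmas DERIV_erf' [derivative_intros] = DERIV_chain2[OF DERIV_erf]

lemma erf_0 [simp]: "erf 0 = 0"
  unfolding erf_def by simp

lemma erf_minus: "erf (- x) = - erf x"
  unfolding erf_def by (subst interval_integral_endpoints_reverse) simp

lemma erf_mono: "x \<le> y \<Longrightarrow> erf x \<le> erf y"
  by (rule DERIV_nonneg_imp_nondecreasing[of x y erf]) (use DERIV_erf in \<open>fastforce+\<close>)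

text \<open>The Gaussian integral over the half-line is \<open>sqrt pi / 2\<close>, and for
  \<open>y \<ge> 0\<close> its part up to \<open>y\<close> is \<open>sqrt pi / 2 * erf y\<close> by
  the fundamental theorem of calculus.\<close>

lemma erf_at_top: "(erf \<longlongrightarrow> 1) at_top"
proof -
  let ?g = "\<lambda>x::real. indicator {0..} x *\<^sub>R exp (- x\<^sup>2)"
  have g: "integrable lborel ?g" "integral\<^sup>L lborel ?g = sqrt pi / 2"
    using gaussian_moment_0 by (auto simp: has_bochner_integral_iff)
  have "((\<lambda>y. \<integral>x. indicator {..y} x *\<^sub>R ?g x \<partial>lborel) \<longlongrightarrow> sqrt pi / 2) at_top"
    using tendsto_integral_at_top[OF sets_lborel g(1)] unfolding g(2) .
  then have "((\<lambda>y. 2 / sqrt pi * (\<integral>x. indicator {..y} x *\<^sub>R ?g x \<partial>lborel)) \<longlongrightarrow>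
      2 / sqrt pi * (sqrt pi / 2)) at_top"
    by (intro tendsto_intros)
  moreover have "\<forall>\<^sub>F y in at_top. 2 / sqrt pi * (\<integral>x. indicator {..y} x *\<^sub>R ?g x \<partial>lborel) = erf y"
  proof (rule eventually_mono[OF eventually_ge_at_top[of 0]])
    fix y :: real assume "0 \<le> y"
    have "(\<integral>x. indicator {..y} x *\<^sub>R ?g x \<partial>lborel) = (\<integral>x. indicator {0..y} x *\<^sub>R exp (- x\<^sup>2) \<partial>lborel)"
      by (intro Bochner_Integration.integral_cong) (auto split: split_indicator)
    also have "\<dots> = sqrt pi / 2 * erf y - sqrt pi / 2 * erf 0"
      using \<open>0 \<le> y\<close>
      by (intro integral_FTC_atLeastAtMost)
        (auto intro!: continuous_intros derivative_eq_intros DERIV_subset[OF DERIV_erf]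
          simp flip: has_real_derivative_iff_has_vector_derivative)
    finally show "2 / sqrt pi * (\<integral>x. indicator {..y} x *\<^sub>R ?g x \<partial>lborel) = erf y"
      by (simp add: field_simps)
  qed
  ultimately show ?thesis
    by (simp add: tendsto_cong)
qed

lemma erf_le_1: "erf x \<le> 1"
  using tendsto_lowerbound[OF erf_at_top, of "erf x"]
  by (auto simp: eventually_at_top_linorder intro: erf_mono)

text \<open>The factor is a convergent of the continued fraction of the Mills ratio.\<close>

lemma erfc_le:
  assumes "0 < z"
  shows "erfc z \<le> 2 / sqrt pi * ((z\<^sup>2 + 1) / (z * (2 * z\<^sup>2 + 3)) * exp (- z\<^sup>2))"
proof -
  \<comment> \<open>\<open>G\<close> tends to 1 and decreases on the positive axis, so
    \<open>G z \<ge> 1\<close>, which is the claim rearranged.\<close>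
  define G where "G = (\<lambda>z::real. erf z + 2 / sqrt pi * ((z\<^sup>2 + 1) / (z * (2 * z\<^sup>2 + 3)) * exp (- z\<^sup>2)))"
  have deriv: "(G has_real_derivative - (2 / sqrt pi * (3 / (x * (2 * x\<^sup>2 + 3))\<^sup>2 * exp (- x\<^sup>2)))) (at x)"
    if "0 < x" for x
  proof -
    have ne: "x * (2 * x\<^sup>2 + 3) \<noteq> 0"
      using that by (simp add: add_nonneg_eq_0_iff)
    have "((\<lambda>z. (z\<^sup>2 + 1) / (z * (2 * z\<^sup>2 + 3))) has_real_derivative
        (2 * x * (x * (2 * x\<^sup>2 + 3)) - (x\<^sup>2 + 1) * (6 * x\<^sup>2 + 3)) / (x * (2 * x\<^sup>2 + 3))\<^sup>2) (at x)"
      using ne by (auto intro!: derivative_eq_intros simp: power2_eq_square algebra_simps)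
    moreover have "((\<lambda>z. exp (- z\<^sup>2)) has_real_derivative - (2 * x) * exp (- x\<^sup>2)) (at x)"
      by (auto intro!: derivative_eq_intros)
    ultimately have "(G has_real_derivative 2 / sqrt pi * exp (- x\<^sup>2) + 2 / sqrt pi *
        ((2 * x * (x * (2 * x\<^sup>2 + 3)) - (x\<^sup>2 + 1) * (6 * x\<^sup>2 + 3)) / (x * (2 * x\<^sup>2 + 3))\<^sup>2 * exp (- x\<^sup>2)
          + - (2 * x) * exp (- x\<^sup>2) * ((x\<^sup>2 + 1) / (x * (2 * x\<^sup>2 + 3))))) (at x)"
      unfolding G_def by (intro DERIV_add DERIV_cmult DERIV_mult DERIV_erf)
    \<comment> \<open>With \<open>q / D\<close> for the fraction and \<open>p / D\<^sup>2\<close>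
      for its derivative, only a polynomial identity remains: all positive powers of
      \<open>x\<close> cancel and \<open>- 3\<close> is left.\<close>
    moreover have "K * e + K * (p / D\<^sup>2 * e + - (2 * x) * e * (q / D)) = - (K * (3 / D\<^sup>2 * e))"
      if "D\<^sup>2 + p - 2 * x * q * D = - 3" "D \<noteq> 0" for K e p q D :: real
    proof -
      have "K * e + K * (p / D\<^sup>2 * e + - (2 * x) * e * (q / D)) = K * e * ((D\<^sup>2 + p - 2 * x * q * D) / D\<^sup>2)"
        using that(2) by (simp add: field_simps power2_eq_square)
      then show ?thesis by (simp add: that(1))
    qed
    moreover have "(x * (2 * x\<^sup>2 + 3))\<^sup>2 + (2 * x * (x * (2 * x\<^sup>2 + 3)) - (x\<^sup>2 + 1) * (6 * x\<^sup>2 + 3))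
        - 2 * x * (x\<^sup>2 + 1) * (x * (2 * x\<^sup>2 + 3)) = - 3"
      by (simp add: power2_eq_square algebra_simps)
    ultimately show ?thesis using ne by metis
  qed
  have "((\<lambda>z::real. (z\<^sup>2 + 1) / (z * (2 * z\<^sup>2 + 3)) * exp (- z\<^sup>2)) \<longlongrightarrow> 0) at_top"
    by real_asymp
  then have "((\<lambda>z::real. erf z + 2 / sqrt pi * ((z\<^sup>2 + 1) / (z * (2 * z\<^sup>2 + 3)) * exp (- z\<^sup>2))) \<longlongrightarrow>
      1 + 2 / sqrt pi * 0) at_top"
    by (intro tendsto_intros erf_at_top)
  then have lim: "(G \<longlongrightarrow> 1) at_top"
    unfolding G_def by simp
  have "G y \<le> G z" if "z \<le> y" for y
  proof (rule DERIV_nonpos_imp_nonincreasing[OF that], intro exI conjI)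
    fix x assume "z \<le> x" "x \<le> y"
    then show "(G has_real_derivative - (2 / sqrt pi * (3 / (x * (2 * x\<^sup>2 + 3))\<^sup>2 * exp (- x\<^sup>2)))) (at x)"
      using assms by (intro deriv) simp
  qed simp
  then have "1 \<le> G z"
    using tendsto_upperbound[OF lim] by (auto simp: eventually_at_top_linorder)
  then show ?thesis
    unfolding G_def erfc_def by simp
qed

text \<open>The derivative of \<open>erf\<close> decreases on the nonnegative axis, so on an
  interval of length \<open>(k - 1) * x\<close> its value at the left end bounds the growth.\<close>

lemma erf_scale_diff_le:
  assumes "0 \<le> x" "1 \<le> k"
  shows "erf (k * x) - erf x \<le> 2 / sqrt pi * ((k - 1) * x * exp (- x\<^sup>2))"
proof -
  have "x \<le> k * x" using assms by (simp add: mult_le_cancel_right1)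
  have "erf (k * x) - 2 / sqrt pi * exp (- x\<^sup>2) * (k * x) \<le> erf x - 2 / sqrt pi * exp (- x\<^sup>2) * x"
  proof (rule DERIV_nonpos_imp_nonincreasing[OF \<open>x \<le> k * x\<close>], intro exI conjI)
    fix u assume "x \<le> u"
    then have "x\<^sup>2 \<le> u\<^sup>2" using assms by (simp add: power_mono)
    then show "2 / sqrt pi * exp (- u\<^sup>2) - 2 / sqrt pi * exp (- x\<^sup>2) \<le> 0"
      by (simp add: divide_right_mono)
    show "((\<lambda>u. erf u - 2 / sqrt pi * exp (- x\<^sup>2) * u) has_real_derivative
        2 / sqrt pi * exp (- u\<^sup>2) - 2 / sqrt pi * exp (- x\<^sup>2)) (at u)"
      using DERIV_diff[OF DERIV_erf DERIV_cmult_Id] .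
  qed
  then show ?thesis by (simp add: algebra_simps)
qed

text \<open>Integrates the tangent bound \<open>exp (- u\<^sup>2) \<ge> exp (- m\<^sup>2) * (1 + m\<^sup>2 - u\<^sup>2)\<close>.\<close>

lemma erf_diff_ge_midpoint:
  assumes "0 \<le> h"
  shows "erf (m + h) - erf (m - h) \<ge> 2 / sqrt pi * (exp (- m\<^sup>2) * (2 * h * (1 - h\<^sup>2 / 3)))"
proof -
  define P where "P u = 2 / sqrt pi * exp (- m\<^sup>2) * ((1 + m\<^sup>2) * u - u ^ 3 / 3)" for u
  have "erf (m - h) - P (m - h) \<le> erf (m + h) - P (m + h)"
  proof (rule DERIV_nonneg_imp_nondecreasing[where f = "\<lambda>u. erf u - P u"])
    fix u
    have "exp (- m\<^sup>2) * (1 + m\<^sup>2 - u\<^sup>2) \<le> exp (- m\<^sup>2) * exp (m\<^sup>2 - u\<^sup>2)"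
      using exp_ge_add_one_self[of "m\<^sup>2 - u\<^sup>2"] by (intro mult_left_mono) (auto simp: add_diff_eq)
    also have "\<dots> = exp (- u\<^sup>2)" by (simp flip: exp_add)
    finally have "0 \<le> 2 / sqrt pi * exp (- u\<^sup>2) - 2 / sqrt pi * exp (- m\<^sup>2) * (1 + m\<^sup>2 - u\<^sup>2)"
      by (simp add: divide_right_mono)
    moreover have "((\<lambda>u. (1 + m\<^sup>2) * u - u ^ 3 / 3) has_real_derivative 1 + m\<^sup>2 - u\<^sup>2) (at u)"
      by (auto intro!: derivative_eq_intros)
    then have "((\<lambda>u. erf u - P u) has_real_derivative
        2 / sqrt pi * exp (- u\<^sup>2) - 2 / sqrt pi * exp (- m\<^sup>2) * (1 + m\<^sup>2 - u\<^sup>2)) (at u)"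
      unfolding P_def by (rule DERIV_diff[OF DERIV_erf DERIV_cmult])
    ultimately show "\<exists>y. ((\<lambda>u. erf u - P u) has_real_derivative y) (at u) \<and> 0 \<le> y"
      by blast
  qed (use assms in simp)
  moreover have "P (m + h) - P (m - h) = 2 / sqrt pi * exp (- m\<^sup>2) * (2 * h * (1 - h\<^sup>2 / 3))"
  proof -
    have "P (m + h) - P (m - h) = 2 / sqrt pi * exp (- m\<^sup>2) *
        (((1 + m\<^sup>2) * (m + h) - (m + h) ^ 3 / 3) - ((1 + m\<^sup>2) * (m - h) - (m - h) ^ 3 / 3))"
      unfolding P_def by (simp add: right_diff_distrib)
    also have "((1 + m\<^sup>2) * (m + h) - (m + h) ^ 3 / 3) - ((1 + m\<^sup>2) * (m - h) - (m - h) ^ 3 / 3)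
        = 2 * h * (1 - h\<^sup>2 / 3)"
      by (simp add: power2_eq_square power3_eq_cube field_simps)
    finally show ?thesis .
  qed
  ultimately show ?thesis by simp
qed

section \<open>Tails of Gaussian increments and marginals\<close>

text \<open>The density has the antiderivative \<open>erf (x / (\<sigma> * sqrt 2)) / 2\<close>,
  which tends to 1/2; this gives the closed upper tail. The open lower tail is the complement of a
  closed upper tail, and \<open>erf\<close> is odd.\<close>

lemma (in prob_space) normal_distributed_tails:
  assumes "distributed M lborel X (normal_density 0 \<sigma>)" "0 < \<sigma>"
  shows "prob {\<omega> \<in> space M. a \<le> X \<omega>} = erfc (a / (\<sigma> * sqrt 2)) / 2"
    and "prob {\<omega> \<in> space M. X \<omega> < - a} = erfc (a / (\<sigma> * sqrt 2)) / 2"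
proof -
  have X [measurable]: "X \<in> borel_measurable M"
    using distributed_measurable[OF assms(1)] by simp
  have upper: "prob {\<omega> \<in> space M. a \<le> X \<omega>} = erfc (a / (\<sigma> * sqrt 2)) / 2" for a
  proof -
    have "emeasure M {\<omega> \<in> space M. a \<le> X \<omega>} = emeasure M (X -` {a..} \<inter> space M)"
      by (intro arg_cong[where f = "emeasure M"]) auto
    also have "\<dots> = (\<integral>\<^sup>+x. ennreal (normal_density 0 \<sigma> x) * indicator {a..} x \<partial>lborel)"
      by (rule distributed_emeasure[OF assms(1)]) simp
    also have "\<dots> = 1 / 2 - erf (a / (\<sigma> * sqrt 2)) / 2"
    proof (rule nn_integral_FTC_atLeast)
      show "((\<lambda>x. erf (x / (\<sigma> * sqrt 2)) / 2) has_real_derivative normal_density 0 \<sigma> x) (at x)" for x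
        using assms(2)
        by (auto intro!: derivative_eq_intros
            simp: normal_density_def real_sqrt_mult power_divide power_mult_distrib)
          (simp add: field_simps)
      have "filterlim (\<lambda>x. x / (\<sigma> * sqrt 2)) at_top at_top"
        using assms(2) by real_asymp
      then show "((\<lambda>x. erf (x / (\<sigma> * sqrt 2)) / 2) \<longlongrightarrow> 1 / 2) at_top"
        by (intro tendsto_divide filterlim_compose[OF erf_at_top]) auto
    qed auto
    finally have "emeasure M {\<omega> \<in> space M. a \<le> X \<omega>} = ennreal (erfc (a / (\<sigma> * sqrt 2)) / 2)"
      by (simp add: erfc_def diff_divide_distrib)
    moreover have "0 \<le> erfc (a / (\<sigma> * sqrt 2)) / 2"
      by (simp add: erfc_def erf_le_1)
    ultimately show ?thesis
      by (simp add: measure_def)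
  qed
  show "prob {\<omega> \<in> space M. a \<le> X \<omega>} = erfc (a / (\<sigma> * sqrt 2)) / 2"
    by (rule upper)
  have "prob {\<omega> \<in> space M. X \<omega> < - a} = 1 - prob {\<omega> \<in> space M. - a \<le> X \<omega>}"
    by (subst prob_compl[symmetric]) (auto intro!: arg_cong[where f = prob])
  also have "\<dots> = erfc (a / (\<sigma> * sqrt 2)) / 2"
    by (simp add: upper erfc_def erf_minus field_simps)
  finally show "prob {\<omega> \<in> space M. X \<omega> < - a} = erfc (a / (\<sigma> * sqrt 2)) / 2" .
qed

context brownian_motion
begin

lemma increment_tails:
  assumes "0 \<le> s" "s < t"
  shows "prob {\<omega> \<in> space M. a \<le> X t \<omega> - X s \<omega>} = erfc (a / sqrt (2 * (t - s))) / 2"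
    and "prob {\<omega> \<in> space M. X t \<omega> - X s \<omega> < - a} = erfc (a / sqrt (2 * (t - s))) / 2"
proof -
  have "sqrt (t - s) * sqrt 2 = sqrt (2 * (t - s))"
    by (simp only: real_sqrt_mult mult.commute)
  then show "prob {\<omega> \<in> space M. a \<le> X t \<omega> - X s \<omega>} = erfc (a / sqrt (2 * (t - s))) / 2"
    and "prob {\<omega> \<in> space M. X t \<omega> - X s \<omega> < - a} = erfc (a / sqrt (2 * (t - s))) / 2"
    using normal_distributed_tails[OF gaussian_increments[OF assms], of a] assms by simp_all
qed

lemma marginal_tails:
  assumes "0 < s"
  shows "prob {\<omega> \<in> space M. \<alpha> + a \<le> X s \<omega>} = erfc (a / sqrt (2 * s)) / 2"
    and "prob {\<omega> \<in> space M. X s \<omega> < \<alpha> - a} = erfc (a / sqrt (2 * s)) / 2"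
proof -
  have [measurable]: "X s \<in> borel_measurable M" "X 0 \<in> borel_measurable M"
    using assms by (auto intro: measurable_X)
  \<comment> \<open>The initial value is \<alpha> only almost surely, so the two events agree up to
    a null set.\<close>
  have "prob {\<omega> \<in> space M. \<alpha> + a \<le> X s \<omega>} = prob {\<omega> \<in> space M. a \<le> X s \<omega> - X 0 \<omega>}"
    by (rule finite_measure_eq_AE) (use initial_value in \<open>auto elim!: eventually_mono\<close>)
  then show "prob {\<omega> \<in> space M. \<alpha> + a \<le> X s \<omega>} = erfc (a / sqrt (2 * s)) / 2"
    using increment_tails(1)[of 0 s a] assms by simp
  have "prob {\<omega> \<in> space M. X s \<omega> < \<alpha> - a} = prob {\<omega> \<in> space M. X s \<omega> - X 0 \<omega> < - a}"
    by (rule finite_measure_eq_AE) (use initial_value in \<open>auto elim!: eventually_mono\<close>)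
  then show "prob {\<omega> \<in> space M. X s \<omega> < \<alpha> - a} = erfc (a / sqrt (2 * s)) / 2"
    using increment_tails(2)[of 0 s a] assms by simp
qed

end

section \<open>The separation event of two paths and its excess probability\<close>

text \<open>By continuity, paths that differ at \<open>u\<close> differ throughout some interval to
  the right of \<open>u\<close>. A rational time there is still at least \<open>s\<close>, so a
  countable union suffices.\<close>

lemma sets_separation:
  fixes M :: "'w measure"
  assumes "brownian_motion M \<alpha> X" "brownian_motion M \<beta> Y" "0 < s"
  shows "{\<omega> \<in> space M. \<exists>u\<ge>s. X u \<omega> \<noteq> Y u \<omega>} \<in> sets M"
proof -
  interpret X: brownian_motion M \<alpha> X by fact
  interpret Y: brownian_motion M \<beta> Y by fact
  have "\<exists>q\<in>\<rat>. s \<le> q \<and> X q \<omega> \<noteq> Y q \<omega>" if \<omega>: "\<omega> \<in> space M" and u: "s \<le> u" "X u \<omega> \<noteq> Y u \<omega>" for \<omega> u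
  proof -
    have "continuous_on {s..} (\<lambda>t. X t \<omega> - Y t \<omega>)"
      using assms(3)
      by (intro continuous_on_diff continuous_on_subset[OF X.continuous_paths[OF \<omega>]]
          continuous_on_subset[OF Y.continuous_paths[OF \<omega>]]) auto
    then have "((\<lambda>t. X t \<omega> - Y t \<omega>) \<longlongrightarrow> X u \<omega> - Y u \<omega>) (at u within {s..})"
      using u by (simp add: continuous_on_def)
    then have "((\<lambda>t. X t \<omega> - Y t \<omega>) \<longlongrightarrow> X u \<omega> - Y u \<omega>) (at_right u)"
      by (rule tendsto_within_subset) (use u in auto)
    then have "\<forall>\<^sub>F t in at_right u. X t \<omega> - Y t \<omega> \<noteq> 0"
      by (rule tendsto_imp_eventually_ne) (use u in simp)
    then obtain b where b: "u < b" "\<And>t. u < t \<Longrightarrow> t < b \<Longrightarrow> X t \<omega> - Y t \<omega> \<noteq> 0"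
      by (auto simp: eventually_at_right_field)
    obtain q where "q \<in> \<rat>" "u < q" "q < b"
      using Rats_dense_in_real[OF b(1)] by blast
    then show ?thesis
      using b(2)[of q] u by (intro bexI[of _ q]) auto
  qed
  then have "{\<omega> \<in> space M. \<exists>u\<ge>s. X u \<omega> \<noteq> Y u \<omega>} =
      (\<Union>q\<in>\<rat> \<inter> {s..}. {\<omega> \<in> space M. X q \<omega> \<noteq> Y q \<omega>})"
    by fastforce
  also have "\<dots> \<in> sets M"
  proof (intro sets.countable_UN'' countable_Int1 countable_rat)
    fix q assume "q \<in> \<rat> \<inter> {s..}"
    then have [measurable]: "X q \<in> borel_measurable M" "Y q \<in> borel_measurable M"
      using assms(3) by (auto intro!: X.measurable_X Y.measurable_X)
    show "{\<omega> \<in> space M. X q \<omega> \<noteq> Y q \<omega>} \<in> sets M"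
      by measurable
  qed
  finally show ?thesis .
qed

text \<open>The events \<open>X s \<ge> (\<alpha> + \<beta>) / 2\<close> and \<open>Y s < (\<alpha> + \<beta>) / 2\<close> are disjoint and exhaustive off \<open>F\<close>. For
  \<open>\<alpha> < \<beta>\<close> their probabilities add up to the overlap of the two marginals, so the sum below is the excess
  of the failure probability over the optimum.\<close>

lemma separated_overlap_eq:
  fixes M :: "'w measure"
  assumes "brownian_motion M \<alpha> X" "brownian_motion M \<beta> Y" "0 < s"
  defines "F \<equiv> {\<omega> \<in> space M. \<exists>u\<ge>s. X u \<omega> \<noteq> Y u \<omega>}"
  shows "measure M ({\<omega> \<in> space M. (\<alpha> + \<beta>) / 2 \<le> X s \<omega>} \<inter> F) +
      measure M ({\<omega> \<in> space M. Y s \<omega> < (\<alpha> + \<beta>) / 2} \<inter> F) =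
      measure M F - erf ((\<beta> - \<alpha>) / (2 * sqrt (2 * s)))"
proof -
  interpret X: brownian_motion M \<alpha> X by fact
  interpret Y: brownian_motion M \<beta> Y by fact
  define A where "A = {\<omega> \<in> space M. (\<alpha> + \<beta>) / 2 \<le> X s \<omega>}"
  define B where "B = {\<omega> \<in> space M. Y s \<omega> < (\<alpha> + \<beta>) / 2}"
  have [measurable]: "X s \<in> borel_measurable M" "Y s \<in> borel_measurable M"
    using assms(3) by (auto intro!: X.measurable_X Y.measurable_X)
  have F: "F \<in> sets M"
    unfolding F_def by (rule sets_separation[OF assms(1-3)])
  have A: "A \<in> sets M" and B: "B \<in> sets M"
    unfolding A_def B_def by measurable
  have mid: "\<alpha> + (\<beta> - \<alpha>) / 2 = (\<alpha> + \<beta>) / 2" "\<beta> - (\<beta> - \<alpha>) / 2 = (\<alpha> + \<beta>) / 2"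
    by (simp_all add: field_simps)
  have "measure M A = erfc ((\<beta> - \<alpha>) / 2 / sqrt (2 * s)) / 2"
    using X.marginal_tails(1)[OF assms(3), of "(\<beta> - \<alpha>) / 2"] mid(1)
    by (simp only: A_def)
  moreover have "measure M B = erfc ((\<beta> - \<alpha>) / 2 / sqrt (2 * s)) / 2"
    using Y.marginal_tails(2)[OF assms(3), of "(\<beta> - \<alpha>) / 2"] mid(2)
    by (simp only: B_def)
  moreover have "measure M (A \<inter> F) = measure M A - measure M (A - F)"
    "measure M (B \<inter> F) = measure M B - measure M (B - F)"
    using X.finite_measure_Diff'[OF A F] X.finite_measure_Diff'[OF B F] by auto
  moreover have "measure M (A - F) + measure M (B - F) = 1 - measure M F"
  proof -
    have "measure M (A - F) + measure M (B - F) = measure M ((A - F) \<union> (B - F))"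
      using A B F by (intro X.finite_measure_Union[symmetric]) (auto simp: A_def B_def F_def)
    also have "(A - F) \<union> (B - F) = space M - F"
      by (auto simp: A_def B_def F_def)
    also have "measure M \<dots> = 1 - measure M F"
      using F by (rule X.prob_compl)
    finally show ?thesis .
  qed
  ultimately show ?thesis
    by (simp add: A_def B_def erfc_def)
qed

section \<open>The inequality from the three paths\<close>

lemma coupling_bound:
  fixes M :: "'w measure"
  assumes X: "brownian_coupling M X"
    and h: "\<And>\<alpha> \<beta> s. 0 < s \<Longrightarrow>
      measure M {\<omega> \<in> space M. \<exists>u\<ge>s. X \<alpha> u \<omega> \<noteq> X \<beta> u \<omega>} \<le> h (\<bar>\<alpha> - \<beta>\<bar> / sqrt s)"
    and st: "0 < s" "s < t"
  shows "erfc (1 / sqrt (2 * t)) - erfc (1 / sqrt (2 * s)) - erfc (1 / (4 * sqrt (2 * (t - s))))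
      \<le> excess h (2 / sqrt t) + excess h (2 / sqrt s) + 2 * excess h (1 / sqrt s)"
proof -
  have bm: "brownian_motion M \<alpha> (X \<alpha>)" for \<alpha>
    using X by (simp add: brownian_coupling_def)
  interpret L: brownian_motion M "- 1" "X (- 1)" by (rule bm)
  interpret R: brownian_motion M 1 "X 1" by (rule bm)
  have [measurable]: "X \<alpha> u \<in> borel_measurable M" if "0 < u" for \<alpha> u
    using brownian_motion.measurable_X[OF bm] that by simp
  have t: "0 < t" using st by simp
  define F where "F \<alpha> \<beta> u = {\<omega> \<in> space M. \<exists>v\<ge>u. X \<alpha> v \<omega> \<noteq> X \<beta> v \<omega>}" for \<alpha> \<beta> u
  have F [measurable]: "F \<alpha> \<beta> u \<in> sets M" if "0 < u" for \<alpha> \<beta> u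
    unfolding F_def by (rule sets_separation[OF bm bm that])
  have overlap: "measure M ({\<omega> \<in> space M. (\<alpha> + \<beta>) / 2 \<le> X \<alpha> s \<omega>} \<inter> F \<alpha> \<beta> s) +
      measure M ({\<omega> \<in> space M. X \<beta> s \<omega> < (\<alpha> + \<beta>) / 2} \<inter> F \<alpha> \<beta> s) =
      measure M (F \<alpha> \<beta> s) - erf ((\<beta> - \<alpha>) / (2 * sqrt (2 * s)))" for \<alpha> \<beta>
    unfolding F_def by (rule separated_overlap_eq[OF bm bm st(1)])
  \<comment> \<open>\<open>A1\<close> and \<open>A2\<close> together carry the excess of the pair
    (-1, 1) at time \<open>s\<close>. \<open>B1\<close> and \<open>B2\<close> each carry one of the
    two summands of the excess for (-1, 0) and (0, 1). \<open>C1\<close> and \<open>C2\<close> are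
    the moves by 1/4 towards the other path.\<close>
  define A1 where "A1 = {\<omega> \<in> space M. 0 \<le> X (- 1) s \<omega>} \<inter> F (- 1) 1 s"
  define A2 where "A2 = {\<omega> \<in> space M. X 1 s \<omega> < 0} \<inter> F (- 1) 1 s"
  define B1 where "B1 = {\<omega> \<in> space M. - 1 / 2 \<le> X (- 1) s \<omega>} \<inter> F (- 1) 0 s"
  define B2 where "B2 = {\<omega> \<in> space M. X 1 s \<omega> < 1 / 2} \<inter> F 0 1 s"
  define C1 where "C1 = {\<omega> \<in> space M. 1 / 4 \<le> X (- 1) t \<omega> - X (- 1) s \<omega>}"
  define C2 where "C2 = {\<omega> \<in> space M. X 1 t \<omega> - X 1 s \<omega> < - (1 / 4)}"
  have meas: "A1 \<in> sets M" "A2 \<in> sets M" "B1 \<in> sets M" "B2 \<in> sets M" "C1 \<in> sets M" "C2 \<in> sets M"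
    unfolding A1_def A2_def B1_def B2_def C1_def C2_def using st t by measurable
  have eq: "2 / sqrt u / (2 * sqrt 2) = 1 / sqrt (2 * u)"
    "1 / sqrt u / (2 * sqrt 2) = 1 / (2 * sqrt (2 * u))" for u
    by (simp_all add: real_sqrt_mult)
  have A: "measure M A1 + measure M A2 = measure M (F (- 1) 1 s) - erf (1 / sqrt (2 * s))"
    using overlap[of "- 1" 1] by (simp add: A1_def A2_def)
  moreover have "measure M (F (- 1) 1 s) \<le> h (2 / sqrt s)"
    using h[OF st(1), of "- 1" 1] by (simp add: F_def)
  ultimately have A': "measure M A1 + measure M A2 \<le> excess h (2 / sqrt s)"
    by (simp add: excess_def eq del: divide_divide_eq_left)
  \<comment> \<open>The other summand of the overlap identity is nonnegative and is dropped.\<close>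
  have "measure M B1 \<le> measure M (F (- 1) 0 s) - erf (1 / (2 * sqrt (2 * s)))"
    using overlap[of "- 1" 0, symmetric] by (simp add: B1_def)
  moreover have "measure M (F (- 1) 0 s) \<le> h (1 / sqrt s)"
    using h[OF st(1), of "- 1" 0] by (simp add: F_def)
  ultimately have B1: "measure M B1 \<le> excess h (1 / sqrt s)"
    by (simp add: excess_def eq del: divide_divide_eq_left)
  have "measure M B2 \<le> measure M (F 0 1 s) - erf (1 / (2 * sqrt (2 * s)))"
    using overlap[of 0 1, symmetric] by (simp add: B2_def)
  moreover have "measure M (F 0 1 s) \<le> h (1 / sqrt s)"
    using h[OF st(1), of 0 1] by (simp add: F_def)
  ultimately have B2: "measure M B2 \<le> excess h (1 / sqrt s)"
    by (simp add: excess_def eq del: divide_divide_eq_left)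
  have C: "measure M C1 = erfc (1 / (4 * sqrt (2 * (t - s)))) / 2"
    "measure M C2 = erfc (1 / (4 * sqrt (2 * (t - s)))) / 2"
    using L.increment_tails(1)[of s t "1 / 4"] R.increment_tails(2)[of s t "1 / 4"] st
    by (auto simp: C1_def C2_def)
  have "space M - F (- 1) 1 t \<subseteq> (space M - F (- 1) 1 s) \<union> (A1 \<union> A2) \<union> (B1 \<union> B2) \<union> (C1 \<union> C2)"
  proof
    fix \<omega> assume \<omega>: "\<omega> \<in> space M - F (- 1) 1 t"
    show "\<omega> \<in> (space M - F (- 1) 1 s) \<union> (A1 \<union> A2) \<union> (B1 \<union> B2) \<union> (C1 \<union> C2)"
    proof (rule ccontr)
      assume *: "\<not> ?thesis"
      then have split: "\<omega> \<in> F (- 1) 1 s"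
        using \<omega> by auto
      then have "X (- 1) s \<omega> < 0" "0 \<le> X 1 s \<omega>"
        using * \<omega> by (auto simp: A1_def A2_def)
      \<comment> \<open>Otherwise both outer paths would agree with the middle one from time
        \<open>s\<close> on, hence with each other.\<close>
      moreover have "X (- 1) s \<omega> < - 1 / 2 \<or> 1 / 2 \<le> X 1 s \<omega>"
      proof (rule ccontr)
        assume "\<not> ?thesis"
        then have "\<omega> \<notin> F (- 1) 0 s" "\<omega> \<notin> F 0 1 s"
          using * \<omega> by (auto simp: B1_def B2_def)
        then show False
          using split by (auto simp: F_def)
      qed
      moreover have "X (- 1) t \<omega> - X (- 1) s \<omega> < 1 / 4" "- (1 / 4) \<le> X 1 t \<omega> - X 1 s \<omega>"
        using * \<omega> by (auto simp: C1_def C2_def)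
      moreover have "X (- 1) t \<omega> = X 1 t \<omega>"
        using \<omega> by (auto simp: F_def)
      \<comment> \<open>The gap at time \<open>s\<close> exceeds 1/2, and the two moves together
        close less than 1/2, so the paths cannot meet at \<open>t\<close>.\<close>
      ultimately show False by linarith
    qed
  qed
  then have "measure M (space M - F (- 1) 1 t)
      \<le> measure M ((space M - F (- 1) 1 s) \<union> (A1 \<union> A2) \<union> (B1 \<union> B2) \<union> (C1 \<union> C2))"
    using meas st by (intro L.finite_measure_mono sets.Un sets.Diff F) auto
  also have "\<dots> \<le> measure M (space M - F (- 1) 1 s) + (measure M A1 + measure M A2)
      + (measure M B1 + measure M B2) + (measure M C1 + measure M C2)"
    using meas st
    by (intro order_trans[OF measure_Un_le] add_mono order_refl sets.Un sets.Diff F measure_Un_le) auto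
  finally have "1 - measure M (F (- 1) 1 t) \<le> 1 - measure M (F (- 1) 1 s) + (measure M A1 + measure M A2)
      + (measure M B1 + measure M B2) + (measure M C1 + measure M C2)"
    using F st by (simp add: L.prob_compl)
  moreover have "measure M (F (- 1) 1 t) \<le> excess h (2 / sqrt t) + erf (1 / sqrt (2 * t))"
    using h[OF t, of "- 1" 1] by (simp add: F_def excess_def eq del: divide_divide_eq_left)
  \<comment> \<open>The coupling inequality: no coupling beats the total variation distance of the
    marginals at time \<open>s\<close>.\<close>
  moreover have "erf (1 / sqrt (2 * s)) \<le> measure M (F (- 1) 1 s)"
    using A measure_nonneg[of M A1] measure_nonneg[of M A2] by linarith
  ultimately show ?thesis
    using A' B1 B2 C by (simp add: erfc_def)
qed

section \<open>Numerical refutation of the gap 1.0025\<close>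

text \<open>The exponents here and in the next two lemmas are
  \<open>1.35\<^sup>2 - y\<^sup>2\<close>, exact or rounded up, for \<open>y\<close> = 1.344, 0.678
  and 2.5312.\<close>

lemma exp_0_016164_le: "exp (0.016164::real) \<le> 1.02"
  using exp_bound[of "0.016164::real"] by (simp add: power2_eq_square)

lemma exp_1_363_le: "exp (1.363::real) \<le> 3.94"
proof -
  obtain t where t: "\<bar>t\<bar> \<le> \<bar>1.363\<bar>"
    "exp (1.363::real) = (\<Sum>m<8. 1.363 ^ m / fact m) + exp t / fact 8 * 1.363 ^ 8"
    using Maclaurin_exp_le[of "1.363" 8] by blast
  \<comment> \<open>The Taylor remainder needs only a crude bound: \<open>t \<le> 2\<close> and
    \<open>exp 1 \<le> 3\<close>.\<close>
  have "exp t \<le> exp (1::real) * exp 1" using t(1) by (simp flip: exp_add)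
  also have "\<dots> \<le> 3 * 3" using exp_le by (intro mult_mono) auto
  finally have "exp t / fact 8 * 1.363 ^ 8 \<le> 9 / fact 8 * 1.363 ^ 8"
    by (intro mult_right_mono divide_right_mono) auto
  moreover have "(\<Sum>m<8. (1.363::real) ^ m / fact m) + 9 / fact 8 * 1.363 ^ 8 \<le> 3.94"
    by (simp add: lessThan_nat_numeral fact_numeral power_divide)
  ultimately show ?thesis using t(2) by linarith
qed

text \<open>At a positive argument the Taylor remainder is nonnegative, so a partial sum bounds
  \<open>exp 4.58\<close> from below; then invert.\<close>

lemma exp_minus_4_58_le: "exp (- 4.58::real) \<le> 0.01031"
proof -
  obtain t where t: "exp (4.58::real) = (\<Sum>m<14. 4.58 ^ m / fact m) + exp t / fact 14 * 4.58 ^ 14"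
    using Maclaurin_exp_le[of "4.58" 14] by blast
  have "1 / 0.01031 \<le> (\<Sum>m<14. (4.58::real) ^ m / fact m)"
    by (simp add: lessThan_nat_numeral fact_numeral power_divide)
  also have "\<dots> \<le> exp (4.58::real)" using t by simp
  finally show ?thesis by (simp add: exp_minus field_simps)
qed

text \<open>Reduces the bound \<open>erf (x / (2 * sqrt 2))\<close> to the larger bound for the gap
  1.0025.\<close>

lemma attainable_failure_bound_mono:
  assumes "attainable_failure_bound TYPE('w) h" "\<And>x. 0 \<le> x \<Longrightarrow> h x \<le> k x" "k \<in> {0..} \<rightarrow> {0..1}"
  shows "attainable_failure_bound TYPE('w) k"
proof -
  obtain M :: "'w measure" and X where X: "brownian_coupling M X"
    "\<forall>\<alpha> \<beta> s. 0 < s \<longrightarrow>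
      measure M {\<omega> \<in> space M. \<exists>t\<ge>s. X \<alpha> t \<omega> \<noteq> X \<beta> t \<omega>} \<le> h (\<bar>\<alpha> - \<beta>\<bar> / sqrt s)"
    using assms(1) unfolding attainable_failure_bound_def by (elim conjE exE)
  have "measure M {\<omega> \<in> space M. \<exists>t\<ge>s. X \<alpha> t \<omega> \<noteq> X \<beta> t \<omega>} \<le> k (\<bar>\<alpha> - \<beta>\<bar> / sqrt s)"
    if "0 < s" for \<alpha> \<beta> s
    using X(2)[rule_format, OF that] by (rule order_trans) (use that in \<open>simp add: assms(2)\<close>)
  then show ?thesis
    using X(1) assms(3) unfolding attainable_failure_bound_def by blast
qed

text \<open>At \<open>x = 2 * sqrt 2 * y\<close> the two error functions have arguments
  \<open>y * sqrt c\<close> and \<open>y\<close>; \<open>k\<close> allows a rational upper bound for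
  \<open>sqrt c\<close>.\<close>

lemma excess_le:
  assumes "0 < y" "sqrt c \<le> k" "1 \<le> k"
  shows "excess (\<lambda>x. erf (x * sqrt c / (2 * sqrt 2))) (2 * sqrt 2 * y)
    \<le> 2 / sqrt pi * ((k - 1) * y * exp (- y\<^sup>2))"
proof -
  have "erf (y * sqrt c) \<le> erf (k * y)"
    using assms by (intro erf_mono) (simp add: mult.commute)
  then show ?thesis
    using erf_scale_diff_le[of y k] assms by (simp add: excess_def)
qed

text \<open>
  The times almost maximise the violation, subject to \<open>1.356\<^sup>2 - 1.344\<^sup>2 = 0.18\<^sup>2\<close>, which makes the
  arguments of all error functions rational. The violation is only about one per cent of the right-hand
  side, so the estimates of \<open>erf\<close> have to be nearly sharp. All terms are compared with the common factor
  \<open>exp (- 1.35\<^sup>2)\<close>, where \<open>1.35\<close> is the midpoint of \<open>1.344\<close> and \<open>1.356\<close>.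
\<close>

lemma gap_inequality_fails:
  defines "h \<equiv> (\<lambda>x. erf (x * sqrt 1.0025 / (2 * sqrt 2)))"
    and "s \<equiv> 1 / (2 * 1.356\<^sup>2)" and "t \<equiv> 1 / (2 * 1.344\<^sup>2)"
  shows "excess h (2 / sqrt t) + excess h (2 / sqrt s) + 2 * excess h (1 / sqrt s)
    < erfc (1 / sqrt (2 * t)) - erfc (1 / sqrt (2 * s)) - erfc (1 / (4 * sqrt (2 * (t - s))))"
proof -
  have sqrt_c: "sqrt 1.0025 \<le> 1.00125"
    by (rule real_le_lsqrt) (simp_all add: power2_eq_square)
  have scale: "2 / sqrt (1 / (2 * y\<^sup>2)) = 2 * sqrt 2 * y" "1 / sqrt (1 / (2 * y\<^sup>2)) = 2 * sqrt 2 * (y / 2)"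
    "1 / sqrt (2 * (1 / (2 * y\<^sup>2))) = y" if "0 < y" for y :: real
    using that by (simp_all add: real_sqrt_mult real_sqrt_divide)
  have args: "2 / sqrt t = 2 * sqrt 2 * 1.344" "2 / sqrt s = 2 * sqrt 2 * 1.356" "1 / sqrt s = 2 * sqrt 2 * 0.678"
    "1 / sqrt (2 * t) = 1.344" "1 / sqrt (2 * s) = 1.356"
    using scale[of "1.344", folded t_def] scale[of "1.356", folded s_def] by simp_all
  \<comment> \<open>The root is \<open>0.18 / (1.344 * 1.356)\<close>, and
    \<open>1.344 * 1.356 / 0.72 = 2.5312\<close>.\<close>
  have "2 * (t - s) = (0.25 / 2.5312)\<^sup>2"
    unfolding s_def t_def by (simp add: power2_eq_square)
  then have "sqrt (2 * (t - s)) = 0.25 / 2.5312"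
    by (simp only: real_sqrt_abs) simp
  then have args': "1 / (4 * sqrt (2 * (t - s))) = 2.5312"
    by (simp only:) simp
  \<comment> \<open>The unit for all terms; its last factor turns \<open>1.00125 - 1\<close> into
    125.\<close>
  define K where "K = 2 / sqrt pi * exp (- (1.35\<^sup>2)) * 0.00001"
  have K: "0 < K" unfolding K_def by simp
  have E: "exp (- (y\<^sup>2)) = exp (- (1.35\<^sup>2)) * exp (1.35\<^sup>2 - y\<^sup>2)" for y :: real
    by (simp flip: exp_add)
  have ex: "excess h (2 * sqrt 2 * y) \<le> K * (125 * y * e)" if "0 < y" "exp (1.35\<^sup>2 - y\<^sup>2) \<le> e" for y e
  proof -
    have "excess h (2 * sqrt 2 * y) \<le> 2 / sqrt pi * ((1.00125 - 1) * y * exp (- y\<^sup>2))"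
      unfolding h_def using that sqrt_c by (intro excess_le) auto
    also have "\<dots> = K * (125 * y * exp (1.35\<^sup>2 - y\<^sup>2))"
      unfolding K_def E[of y] by simp
    also have "\<dots> \<le> K * (125 * y * e)"
      using that K by (intro mult_left_mono) auto
    finally show ?thesis .
  qed
  have "excess h (2 / sqrt t) \<le> K * (125 * 1.344 * 1.02)"
    unfolding args using exp_0_016164_le by (intro ex) (simp_all add: power2_eq_square)
  moreover have "excess h (2 / sqrt s) \<le> K * (125 * 1.356 * 1)"
    unfolding args by (intro ex) (simp_all add: power2_eq_square)
  moreover have "excess h (1 / sqrt s) \<le> K * (125 * 0.678 * 3.94)"
  proof -
    have "exp (1.35\<^sup>2 - 0.678\<^sup>2) \<le> exp (1.363::real)" by (simp add: power2_eq_square)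
    from order_trans[OF this exp_1_363_le] show ?thesis
      unfolding args by (intro ex) auto
  qed
  moreover have "erfc 2.5312 \<le> K * (18505 * 0.01031)"
  proof -
    have "erfc 2.5312 \<le> 2 / sqrt pi * ((2.5312\<^sup>2 + 1) / (2.5312 * (2 * 2.5312\<^sup>2 + 3)) * exp (- (2.5312\<^sup>2)))"
      by (rule erfc_le) simp
    also have "\<dots> \<le> 2 / sqrt pi * (0.18505 * exp (- (2.5312\<^sup>2)))"
      by (intro mult_left_mono mult_right_mono) (simp_all add: power2_eq_square)
    also have "\<dots> = K * (18505 * exp (1.35\<^sup>2 - 2.5312\<^sup>2))"
      unfolding K_def E[of "2.5312"] by simp
    also have "\<dots> \<le> K * (18505 * 0.01031)"
    proof -
      have "exp (1.35\<^sup>2 - 2.5312\<^sup>2) \<le> exp (- 4.58::real)" by (simp add: power2_eq_square)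
      from order_trans[OF this exp_minus_4_58_le] show ?thesis
        using K by (intro mult_left_mono) auto
    qed
    finally show ?thesis .
  qed
  moreover have "K * 1199.98 \<le> erf 1.356 - erf 1.344"
  proof -
    have "K * 1199.98 = 2 / sqrt pi * (exp (- (1.35\<^sup>2)) * 0.0119998)"
      unfolding K_def by simp
    also have "\<dots> \<le> 2 / sqrt pi * (exp (- (1.35\<^sup>2)) * (2 * 0.006 * (1 - 0.006\<^sup>2 / 3)))"
      by (intro mult_left_mono) (simp_all add: power2_eq_square)
    also have "\<dots> \<le> erf (1.35 + 0.006) - erf (1.35 - 0.006)"
      by (rule erf_diff_ge_midpoint) simp
    finally show ?thesis by simp
  qed
  \<comment> \<open>In units of \<open>K\<close> the sides are about 1008.69 and 1009.19.\<close>
  moreover have "K * (125 * 1.344 * 1.02) + K * (125 * 1.356 * 1) + 2 * (K * (125 * 0.678 * 3.94))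
      < K * 1199.98 - K * (18505 * 0.01031)"
    using K by simp
  ultimately show ?thesis
    unfolding args args' erfc_def by linarith
qed

theorem theorem5:
  shows "(\<forall>h :: real \<Rightarrow> real. attainable_failure_bound TYPE('w) h \<longrightarrow>
           (\<forall>s t :: real. 0 < s \<and> s < t \<longrightarrow>
             excess h (2 / sqrt t) + excess h (2 / sqrt s) + 2 * excess h (1 / sqrt s)
               \<ge> erfc (1 / sqrt (2 * t)) - erfc (1 / sqrt (2 * s))
                  - erfc (1 / (4 * sqrt (2 * (t - s))))))
       \<and> \<not> attainable_failure_bound TYPE('w) (\<lambda>x. erf (x / (2 * sqrt 2)))
       \<and> \<not> attainable_multiplicative_gap TYPE('w) 1.0025"
proof (intro conjI)
  have bound: "erfc (1 / sqrt (2 * t)) - erfc (1 / sqrt (2 * s)) - erfc (1 / (4 * sqrt (2 * (t - s))))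
      \<le> excess h (2 / sqrt t) + excess h (2 / sqrt s) + 2 * excess h (1 / sqrt s)"
    if h: "attainable_failure_bound TYPE('w) h" and st: "0 < s" "s < t" for h s t
  proof -
    obtain M :: "'w measure" and X where X: "brownian_coupling M X"
      "\<forall>\<alpha> \<beta> s. 0 < s \<longrightarrow>
        measure M {\<omega> \<in> space M. \<exists>t\<ge>s. X \<alpha> t \<omega> \<noteq> X \<beta> t \<omega>} \<le> h (\<bar>\<alpha> - \<beta>\<bar> / sqrt s)"
      using h unfolding attainable_failure_bound_def by (elim conjE exE)
    from X(1) X(2)[rule_format] st show ?thesis
      by (rule coupling_bound)
  qed
  then show "\<forall>h :: real \<Rightarrow> real. attainable_failure_bound TYPE('w) h \<longrightarrow>
      (\<forall>s t :: real. 0 < s \<and> s < t \<longrightarrow>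
        excess h (2 / sqrt t) + excess h (2 / sqrt s) + 2 * excess h (1 / sqrt s)
          \<ge> erfc (1 / sqrt (2 * t)) - erfc (1 / sqrt (2 * s))
             - erfc (1 / (4 * sqrt (2 * (t - s)))))"
    by blast
  \<comment> \<open>Both remaining claims follow from this one, the bound without the factor by
    monotonicity.\<close>
  have not_c: "\<not> attainable_failure_bound TYPE('w) (\<lambda>x. erf (x * sqrt 1.0025 / (2 * sqrt 2)))"
  proof
    assume "attainable_failure_bound TYPE('w) (\<lambda>x. erf (x * sqrt 1.0025 / (2 * sqrt 2)))"
    from bound[OF this, of "1 / (2 * 1.356\<^sup>2)" "1 / (2 * 1.344\<^sup>2)"] gap_inequality_fails
    show False
      by (simp only: not_less[symmetric]) (simp add: power2_eq_square)
  qed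
  show "\<not> attainable_multiplicative_gap TYPE('w) 1.0025"
    using not_c unfolding attainable_multiplicative_gap_def by blast
  show "\<not> attainable_failure_bound TYPE('w) (\<lambda>x. erf (x / (2 * sqrt 2)))"
  proof
    assume "attainable_failure_bound TYPE('w) (\<lambda>x. erf (x / (2 * sqrt 2)))"
    then have "attainable_failure_bound TYPE('w) (\<lambda>x. erf (x * sqrt 1.0025 / (2 * sqrt 2)))"
    proof (rule attainable_failure_bound_mono)
      fix x :: real assume "0 \<le> x"
      then have "x \<le> x * sqrt 1.0025"
        by (simp add: mult_le_cancel_left1)
      then show "erf (x / (2 * sqrt 2)) \<le> erf (x * sqrt 1.0025 / (2 * sqrt 2))"
        by (intro erf_mono divide_right_mono) auto
    next
      show "(\<lambda>x. erf (x * sqrt 1.0025 / (2 * sqrt 2))) \<in> {0..} \<rightarrow> {0..1}"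
      proof
        fix x :: real assume "x \<in> {0..}"
        then have "erf 0 \<le> erf (x * sqrt 1.0025 / (2 * sqrt 2))"
          by (intro erf_mono) simp
        then show "erf (x * sqrt 1.0025 / (2 * sqrt 2)) \<in> {0..1}"
          by (simp add: erf_le_1)
      qed
    qed
    with not_c show False ..
  qed
qed

end
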